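(* Consider the self-adjusting single-source tree problem on a complete binary tree $T$ with $n$ nodes and a set $E$ of $n$ elements, in the setting described in the context. For every finite request sequence $\sigma$ and every offline algorithm $\textsc{Opt}$ that starts from the same initial placement of elements as \textsc{Rotor-Push}, the total cost of \textsc{Rotor-Push} on $\sigma$ is at most $12$ times the total cost of $\textsc{Opt}$ on $\sigma$. That is, \textsc{Rotor-Push} is $12$-competitive.
   Context: Problem: $T$ is a complete binary tree; its root $r_T$ has level $0$ and the level $\ell(v)$ of a node is its distance from the root. There is a set $E$ of $n$ elements, and at all times each node holds exactly one element ($\mathrm{nd}(e)$ is the node holding $e$, $\mathrm{el}(v)$ the element at $v$; $\ell(e)=\ell(\mathrm{nd}(e))$). Requests $\sigma=\sigma^1,\sigma^2,\dots$ are elements of $E$, revealed online. Serving a request to $e$ costs $\ell(e)+1$ (access cost); in addition, any swap of the elements at two adjacent nodes (a node and its parent) costs $1$. The total cost of an algorithm is the sum of all access costs and swap costs. The offline algorithm $\textsc{Opt}$ knows the whole sequence and may perform arbitrary swaps of adjacent elements at any time at unit cost each. Augmented push-down $\mathrm{PD}(u,v)$ for two nodes $u,v$ on the same level $d$: let $r_T=v_0,v_1,\dots,v_d=v$ be the root-to-$v$ path; consider the cycle of nodes $v_0\to v_1\to\dots\to v_d\to u\to v_0$ and move each element on a node of this cycle to the next node of the cycle (so $\mathrm{el}(u)$ goes to the root, $\mathrm{el}(v_i)$ goes to $v_{i+1}$ for $i<d$, and $\mathrm{el}(v)$ goes to $u$; if $u=v$ the element at $v$ goes to the root and the path elements shift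 down by one). It is implemented by adjacent swaps as follows: if $u=v$, the element at $v$ is swapped up to the root; otherwise the element $\mathrm{el}(v)$ is swapped up along the path to the root, then swapped down along the root-to-$u$ path to $u$, and finally the element originally at $u$ (now at the parent of $u$) is swapped up to the root. The algorithm's cost for a request is its access cost plus the number of these swaps. \textsc{Rotor-Push}: each non-leaf node has a rotor pointer to one of its children, initially the left child. The global path $P$ is the root-to-leaf path obtained by starting at $r_T$ and following pointers; $P_d$ denotes its node at level $d$. The operation $\mathrm{flip}(d)$ toggles the pointers of all nodes $P_{d'}$ with $d'<d$. Upon a request to element $e^*$ at level $d^*$, \textsc{Rotor-Push} sets $v=P_{d^*}$ (possibly $v=\mathrm{nd}(e^* )$), executes $\mathrm{PD}(\mathrm{nd}(e^* ),v)$, and then executes $\mathrm{flip}(d^* )$. *)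

theory Defs
  imports Main "HOL-Library.Sublist"
begin

text \<open>A node is the list of turns on the path from the root to it (\<^term>\<open>False\<close>: left,
  \<^term>\<open>True\<close>: right). So the root is \<^term>\<open>[]\<close>, the level of \<open>v\<close> is \<^term>\<open>length v\<close>, the
  children of \<open>v\<close> are \<open>v @ [False]\<close> and \<open>v @ [True]\<close>, the parent is \<^term>\<open>butlast v\<close>, and
  \<^term>\<open>prefixes v\<close> is the root-to-\<open>v\<close> path.\<close>

type_synonym node = "bool list"

definition tree_nodes :: "nat \<Rightarrow> node set" where
  "tree_nodes h = {v. length v \<le> h}"

text \<open>Only the values on \<^term>\<open>tree_nodes h\<close> matter.\<close>

type_synonym 'a placement = "node \<Rightarrow> 'a"

definition nd :: "nat \<Rightarrow> 'a placement \<Rightarrow> 'a \<Rightarrow> node" where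
  "nd h el e = inv_into (tree_nodes h) el e"

definition swap_with_parent :: "node \<Rightarrow> 'a placement \<Rightarrow> 'a placement" where
  "swap_with_parent v el = el(v := el (butlast v), butlast v := el v)"

text \<open>\<open>Swap v\<close> swaps the elements at \<open>v\<close> and at its parent.\<close>

datatype 'a action = Swap node | Serve 'a

fun total_cost :: "nat \<Rightarrow> 'a placement \<Rightarrow> 'a action list \<Rightarrow> nat" where
  "total_cost h el [] = 0"
| "total_cost h el (Swap v # as) = 1 + total_cost h (swap_with_parent v el) as"
| "total_cost h el (Serve e # as) = length (nd h el e) + 1 + total_cost h el as"

fun served :: "'a action list \<Rightarrow> 'a list" where
  "served [] = []"
| "served (Swap v # as) = served as"
| "served (Serve e # as) = e # served as"

definition is_schedule :: "nat \<Rightarrow> 'a list \<Rightarrow> 'a action list \<Rightarrow> bool" where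
  "is_schedule h \<sigma> as \<longleftrightarrow>
     (\<forall>v. Swap v \<in> set as \<longrightarrow> v \<in> tree_nodes h \<and> v \<noteq> []) \<and> served as = \<sigma>"

definition offline_algorithm :: "nat \<Rightarrow> 'a set \<Rightarrow> ('a list \<Rightarrow> 'a action list) \<Rightarrow> bool" where
  "offline_algorithm h E A \<longleftrightarrow> (\<forall>\<sigma> \<in> lists E. is_schedule h \<sigma> (A \<sigma>))"

text \<open>The new contents of each node after the augmented push-down, for \<open>u\<close>, \<open>v\<close> on the same
  level; a node \<open>w \<noteq> []\<close> on the root-to-\<open>v\<close> path receives the element of its predecessor on
  that path, which is its parent.\<close>

definition PD :: "node \<Rightarrow> node \<Rightarrow> 'a placement \<Rightarrow> 'a placement" where
  "PD u v el = (\<lambda>w. if w = [] then el u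
                    else if prefix w v then el (butlast w)
                    else if w = u then el v
                    else el w)"

text \<open>Swaps are named by their lower endpoint.\<close>

definition up_swaps :: "node \<Rightarrow> node list" where
  "up_swaps v = rev (tl (prefixes v))"

definition down_swaps :: "node \<Rightarrow> node list" where
  "down_swaps v = tl (prefixes v)"

definition PD_swaps :: "node \<Rightarrow> node \<Rightarrow> node list" where
  "PD_swaps u v = (if u = v then up_swaps v
                   else up_swaps v @ down_swaps u @ up_swaps (butlast u))"

text \<open>A rotor state gives the direction in which each pointer points; its values at leaves
  and outside the tree are never used.\<close>

type_synonym rotors = "node \<Rightarrow> bool"

definition initial_rotors :: rotors where
  "initial_rotors = (\<lambda>_. False)"

fun global_path :: "rotors \<Rightarrow> nat \<Rightarrow> node" where
  "global_path rot 0 = []"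
| "global_path rot (Suc d) = global_path rot d @ [rot (global_path rot d)]"

definition flip :: "nat \<Rightarrow> rotors \<Rightarrow> rotors" where
  "flip d rot = (\<lambda>w. if \<exists>d'<d. w = global_path rot d' then \<not> rot w else rot w)"

fun rotor_push :: "nat \<Rightarrow> 'a placement \<Rightarrow> rotors \<Rightarrow> 'a list \<Rightarrow> 'a action list" where
  "rotor_push h el rot [] = []"
| "rotor_push h el rot (e # \<sigma>) =
     (let u = nd h el e; d = length u; v = global_path rot d
      in Serve e # map Swap (PD_swaps u v) @ rotor_push h (PD u v el) (flip d rot) \<sigma>)"

lemma tl_prefixes_snoc: "tl (prefixes (w @ [b])) = tl (prefixes w) @ [w @ [b]]"
  by (cases w) (simp_all add: prefixes_snoc)

lemma not_prefix_snoc_self [simp]: "\<not> prefix (w @ [b]) w"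
  by (auto dest: prefix_length_le)

lemma fold_up_swaps:
  "fold swap_with_parent (up_swaps w) el =
     (\<lambda>x. if x = [] then el w else if prefix x w then el (butlast x) else el x)"
proof (induction w arbitrary: el rule: rev_induct)
  case Nil
  then show ?case by (auto simp: up_swaps_def)
next
  case (snoc b w)
  have "up_swaps (w @ [b]) = (w @ [b]) # up_swaps w"
    by (simp add: up_swaps_def tl_prefixes_snoc)
  then have eq: "fold swap_with_parent (up_swaps (w @ [b])) el =
      fold swap_with_parent (up_swaps w) (swap_with_parent (w @ [b]) el)"
    by simp
  have "butlast x \<noteq> w \<and> butlast x \<noteq> w @ [b]" if "prefix x w" "x \<noteq> []" for x
  proof -
    have "length (butlast x) < length w"
      using prefix_length_le[OF that(1)] that(2) by (cases x) auto
    then show ?thesis by (auto simp del: length_butlast)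
  qed
  then show ?case
    unfolding eq snoc.IH by (auto simp: swap_with_parent_def fun_eq_iff prefix_snoc)
qed

lemma fold_down_swaps:
  "fold swap_with_parent (down_swaps w) el =
     (\<lambda>x. if x = w then el []
          else if prefix x w then el (take (Suc (length x)) w) else el x)"
proof (induction w arbitrary: el rule: rev_induct)
  case Nil
  then show ?case by (auto simp: down_swaps_def)
next
  case (snoc b w)
  have "down_swaps (w @ [b]) = down_swaps w @ [w @ [b]]"
    by (simp add: down_swaps_def tl_prefixes_snoc)
  then have eq: "fold swap_with_parent (down_swaps (w @ [b])) el =
      swap_with_parent (w @ [b]) (fold swap_with_parent (down_swaps w) el)"
    by simp
  have "Suc (length x) - length w = 0" if "prefix x w" "x \<noteq> w" for x
    using that by (auto simp: prefix_def Suc_le_eq)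
  then show ?case
    unfolding eq snoc.IH by (auto simp: swap_with_parent_def fun_eq_iff prefix_snoc)
qed

lemma PD_implementation:
  assumes "length u = length v"
  shows "fold swap_with_parent (PD_swaps u v) el = PD u v el"
proof (cases "u = v")
  case True
  then show ?thesis
    by (auto simp: PD_swaps_def fold_up_swaps PD_def fun_eq_iff)
next
  case False
  then obtain u' b where u: "u = u' @ [b]"
    using assms by (cases u rule: rev_cases) auto
  have "\<not> prefix u v"
    using False assms by (auto simp: prefix_def)
  then have nu: "\<not> prefix (u' @ [b]) v"
    by (simp add: u)
  have neq: "butlast x \<noteq> u' @ [b]" if "prefix x u'" for x
  proof -
    have "length (butlast x) < length (u' @ [b])"
      using prefix_length_le[OF that] by simp
    then show ?thesis by (auto simp del: length_butlast)
  qed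
  have pre: "prefix (butlast x) (u' @ [b])" if "prefix x u'" for x
    using that by (meson prefix_order.trans prefixeq_butlast prefix_prefix)
  have tk: "take (length x) u' = x" if "prefix x u'" for x
    using that by (auto simp: prefix_def)
  have len: "Suc (length x - Suc 0) = length x" if "x \<noteq> []" for x :: node
    using that by (cases x) auto
  have eq: "fold swap_with_parent (PD_swaps u v) el =
      fold swap_with_parent (up_swaps u')
        (fold swap_with_parent (down_swaps u) (fold swap_with_parent (up_swaps v) el))"
    using False by (simp add: PD_swaps_def u)
  show ?thesis
  proof
    fix x
    consider "x = []" | "x \<noteq> []" "prefix x u'" | "x \<noteq> []" "\<not> prefix x u'" by blast
    then show "fold swap_with_parent (PD_swaps u v) el x = PD u v el x"
    proof cases
      case 1
      then show ?thesis
        unfolding eq unfolding fold_up_swaps fold_down_swaps PD_def u using nu by simp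
    next
      case 2
      then show ?thesis
        unfolding eq unfolding fold_up_swaps fold_down_swaps PD_def u
        using nu neq[OF 2(2)] pre[OF 2(2)] tk[OF 2(2)] len[OF 2(1)]
          prefix_length_le[OF 2(2)] by auto
    next
      case 3
      then show ?thesis
        unfolding eq unfolding fold_up_swaps fold_down_swaps PD_def u
        using nu by (auto simp: prefix_snoc)
    qed
  qed
qed

end

theory Submission
  imports Defs Complex_Main "HOL-Combinatorics.Transposition"
begin

text \<open>
  The flip-rank of a node \<open>v\<close> on level \<open>d\<close> is the number of \<open>flip(d)\<close> operations after which the
  global path reaches \<open>v\<close>. Give an element at \<open>v\<close> the weight \<open>d + 1 - rank / 2 ^ d\<close>: when a
  push-down moves an element one level down, its rank jumps from \<open>0\<close> to the maximum, so its
  weight grows continuously, and in each request every element other than the requested one gains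
  at most \<open>2\<close> to the minus its new level. The potential charges \<open>4\<close> times the excess of the weight
  over \<open>2 k + 1\<close>, with \<open>k\<close> the level of the element in Opt's tree. Only elements whose level in
  Rotor-Push's tree exceeds \<open>2 k\<close> have an excess; as Opt's level \<open>k\<close> holds \<open>2 ^ k\<close> elements, the
  total gain of all excesses in a request is at most \<open>1\<close>. A request on level \<open>d\<close> costs at most
  \<open>4 d + 1\<close> and frees \<open>4 (d - 2 k - 1)\<close> of potential, and a swap of Opt adds at most \<open>8\<close>.
\<close>

section \<open>Flip-ranks\<close>

text \<open>A binary countdown, with a digit 1 for each pointer that points away from
  \<open>v\<close>. The root holds the lowest digit because its pointer toggles most often.\<close>

definition flip_rank :: "rotors \<Rightarrow> node \<Rightarrow> nat" where
  "flip_rank rot v = (\<Sum>i<length v. if rot (take i v) = v ! i then 0 else 2 ^ i)"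

lemma flip_rank_Nil [simp]: "flip_rank rot [] = 0"
  by (simp add: flip_rank_def)

lemma flip_rank_snoc [simp]:
  "flip_rank rot (v @ [b]) = flip_rank rot v + (if rot v = b then 0 else 2 ^ length v)"
  by (simp add: flip_rank_def nth_append)

lemma length_global_path [simp]: "length (global_path rot d) = d"
  by (induction d) auto

lemma prefix_global_pathD:
  "prefix w (global_path rot d) \<Longrightarrow> w = global_path rot (length w) \<and> length w \<le> d"
  by (induction d) (auto simp: prefix_snoc)

lemma prefix_global_path: "i \<le> d \<Longrightarrow> prefix (global_path rot i) (global_path rot d)"
  by (induction d) (auto simp: le_Suc_eq prefix_snoc)

lemma flip_rank_global_path [simp]: "flip_rank rot (global_path rot d) = 0"
  by (induction d) auto

lemma flip_global_path: "i < d \<Longrightarrow> flip d rot (global_path rot i) = (\<not> rot (global_path rot i))"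
  by (auto simp: flip_def)

lemma flip_other: "v \<noteq> global_path rot (length v) \<or> d \<le> length v \<Longrightarrow> flip d rot v = rot v"
  unfolding flip_def by (metis length_global_path not_less)

text \<open>All pointers above level \<open>i\<close> on the path have turned away, so all
  \<open>i\<close> digits are 1.\<close>

lemma flip_rank_flip_global_path:
  "i \<le> d \<Longrightarrow> flip_rank (flip d rot) (global_path rot i) = 2 ^ i - 1"
  by (induction i) (auto simp: flip_global_path)

text \<open>Borrowing: an untoggled pointer at \<open>v\<close> keeps its digit. A toggled one loses
  at most \<open>2 ^ length v\<close>, while the lower digits jump from 0 to
  \<open>2 ^ length v - 1\<close>.\<close>

lemma flip_rank_flip: "flip_rank rot v \<le> flip_rank (flip d rot) v + 1"
proof (induction v rule: rev_induct)
  case (snoc b v)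
  show ?case
  proof (cases "v = global_path rot (length v)")
    case True
    then have "flip_rank rot v = 0"
      by (metis flip_rank_global_path)
    moreover have "flip_rank (flip d rot) v = 2 ^ length v - 1" if "length v < d"
      using that True flip_rank_flip_global_path[of "length v" d rot] by simp
    ultimately show ?thesis
      using flip_other[of v rot d] by (cases "length v < d") auto
  qed (use snoc flip_other[of v rot d] in auto)
qed simp

section \<open>Weights of nodes\<close>

definition weight :: "rotors \<Rightarrow> node \<Rightarrow> real" where
  "weight rot v = real (length v) + 1 - real (flip_rank rot v) / 2 ^ length v"

lemma flip_rank_less: "flip_rank rot v < 2 ^ length v"
  by (induction v rule: rev_induct) auto

lemma weight_le: "weight rot v \<le> real (length v) + 1"
  by (simp add: weight_def)

lemma weight_ge: "real (length v) \<le> weight rot v"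
proof -
  have "real (flip_rank rot v) < 2 ^ length v"
    using flip_rank_less[of rot v] by (metis of_nat_less_iff of_nat_numeral of_nat_power)
  then show ?thesis
    by (simp add: weight_def)
qed

lemma weight_global_path: "weight rot (global_path rot d) = real d + 1"
  by (simp add: weight_def)

lemma weight_flip: "weight (flip d rot) v \<le> weight rot v + (1 / 2) ^ length v"
proof -
  have "real (flip_rank rot v) \<le> real (flip_rank (flip d rot) v) + 1"
    using flip_rank_flip[of rot v d] by linarith
  then have "real (flip_rank rot v) / 2 ^ length v
      \<le> (real (flip_rank (flip d rot) v) + 1) / 2 ^ length v"
    by (intro divide_right_mono) auto
  then show ?thesis
    by (simp add: weight_def add_divide_distrib power_one_over)
qed

text \<open>An element pushed from level \<open>i\<close>, with weight \<open>i + 1\<close>, to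
  level \<open>i + 1\<close> thus gains only \<open>(1 / 2) ^ (i + 1)\<close>.\<close>

lemma weight_flip_global_path:
  "i \<le> d \<Longrightarrow> weight (flip d rot) (global_path rot i) = real i + (1 / 2) ^ i"
  by (simp add: weight_def flip_rank_flip_global_path of_nat_diff diff_divide_distrib power_one_over)

section \<open>Placements\<close>

lemma butlast_in_tree_nodes: "v \<in> tree_nodes h \<Longrightarrow> butlast v \<in> tree_nodes h"
  by (auto simp: tree_nodes_def)

lemma bij_swap_with_parent:
  assumes "bij_betw el (tree_nodes h) E" "v \<in> tree_nodes h" "v \<noteq> []"
  shows "bij_betw (swap_with_parent v el) (tree_nodes h) E"
proof -
  have "swap_with_parent v el = el \<circ> transpose v (butlast v)"
    by (auto simp: swap_with_parent_def transpose_def fun_eq_iff)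
  moreover have "bij_betw (transpose v (butlast v)) (tree_nodes h) (tree_nodes h)"
    using assms(2) butlast_in_tree_nodes by (simp add: bij_betw_transpose_iff)
  ultimately show ?thesis
    using assms(1) by (auto intro: bij_betw_trans)
qed

lemma set_PD_swaps: "w \<in> set (PD_swaps u v) \<Longrightarrow> w \<noteq> [] \<and> (prefix w u \<or> prefix w v)"
proof -
  have "set (tl (prefixes x)) = {w. w \<noteq> [] \<and> prefix w x}" for x :: node
    by (induction x rule: rev_induct) (auto simp: tl_prefixes_snoc prefix_snoc)
  moreover assume "w \<in> set (PD_swaps u v)"
  ultimately show ?thesis
    using prefix_order.trans[OF _ prefixeq_butlast, of w u]
    by (auto simp: PD_swaps_def up_swaps_def down_swaps_def split: if_splits)
qed

text \<open>With \<open>d\<close> the common level: \<open>d\<close> swaps up from \<open>v\<close>,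
  and if \<open>u\<close> differs from \<open>v\<close>, also \<open>d\<close> down to
  \<open>u\<close> and \<open>d - 1\<close> up from its parent.\<close>

lemma length_PD_swaps: "length u = length v \<Longrightarrow> length (PD_swaps u v) \<le> 3 * length v"
  by (auto simp: PD_swaps_def up_swaps_def down_swaps_def)

lemma bij_fold_swaps:
  assumes "bij_betw el (tree_nodes h) E" "\<And>w. w \<in> set ws \<Longrightarrow> w \<in> tree_nodes h \<and> w \<noteq> []"
  shows "bij_betw (fold swap_with_parent ws el) (tree_nodes h) E"
  using assms by (induction ws arbitrary: el) (auto intro: bij_swap_with_parent)

text \<open>Bijectivity passes through the implementation by swaps, each a transposition of two tree
  nodes.\<close>

lemma bij_PD:
  assumes "bij_betw el (tree_nodes h) E" "u \<in> tree_nodes h" "length u = length v"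
  shows "bij_betw (PD u v el) (tree_nodes h) E"
  unfolding PD_implementation[OF assms(3), symmetric]
proof (rule bij_fold_swaps[OF assms(1)])
  fix w
  assume "w \<in> set (PD_swaps u v)"
  then show "w \<in> tree_nodes h \<and> w \<noteq> []"
    using set_PD_swaps[of w u v] assms(2,3)
    by (auto simp: tree_nodes_def dest: prefix_length_le)
qed

lemma nd_eqI:
  "bij_betw el (tree_nodes h) E \<Longrightarrow> p \<in> tree_nodes h \<Longrightarrow> el p = e \<Longrightarrow> nd h el e = p"
  by (auto simp: nd_def bij_betw_def)

lemma nd_bij:
  assumes "bij_betw el (tree_nodes h) E" "e \<in> E"
  shows "nd h el e \<in> tree_nodes h" "el (nd h el e) = e"
  using assms by (auto simp: nd_def bij_betw_def inv_into_into f_inv_into_f)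

text \<open>Only \<open>el v\<close> moves up. The element at the parent moves down, which a lower
  bound on the new level may ignore.\<close>

lemma level_nd_swap:
  assumes el: "bij_betw el (tree_nodes h) E" and v: "v \<in> tree_nodes h" "v \<noteq> []" and e: "e \<in> E"
  shows "length (nd h el e) \<le> length (nd h (swap_with_parent v el) e) + (if e = el v then 1 else 0)"
proof -
  define p where "p = nd h el e"
  have p: "p \<in> tree_nodes h" "el p = e"
    using nd_bij[OF el e] by (auto simp: p_def)
  have *: "butlast v \<noteq> v"
    using v(2) by (metis append_butlast_last_id not_Cons_self2 append_self_conv)
  note I = nd_eqI[OF bij_swap_with_parent[OF el v]]
  consider "p = v" | "p = butlast v" | "p \<noteq> v" "p \<noteq> butlast v" by blast
  then show ?thesis
  proof cases
    case 1
    have "nd h (swap_with_parent v el) e = butlast v"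
      using p 1 by (intro I) (auto simp: swap_with_parent_def butlast_in_tree_nodes)
    then show ?thesis using 1 p by (simp add: p_def[symmetric])
  next
    case 2
    have "nd h (swap_with_parent v el) e = v"
      using p 2 v * by (intro I) (auto simp: swap_with_parent_def)
    then show ?thesis using 2 p by (simp add: p_def[symmetric])
  next
    case 3
    have "nd h (swap_with_parent v el) e = p"
      using p 3 by (intro I) (auto simp: swap_with_parent_def)
    then show ?thesis by (simp add: p_def[symmetric])
  qed
qed

section \<open>Weight gain in one request\<close>

text \<open>Three kinds of elements: those on the path above \<open>v\<close>, the one at
  \<open>v\<close>, and those off the path, which feel only the flip.\<close>

lemma weight_gain:
  assumes el: "bij_betw el (tree_nodes h) E" and e: "e \<in> E" and r: "r \<in> E" "e \<noteq> r"
    and u: "u = nd h el r" and d: "d = length u" and v: "v = global_path rot d"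
  shows "weight (flip d rot) (nd h (PD u v el) e)
    \<le> weight rot (nd h el e) + (1 / 2) ^ length (nd h (PD u v el) e)"
proof -
  define p where "p = nd h el e"
  have p: "p \<in> tree_nodes h" "el p = e"
    using nd_bij[OF el e] by (auto simp: p_def)
  have u': "u \<in> tree_nodes h" "el u = r"
    using nd_bij[OF el r(1)] by (auto simp: u)
  have lv: "length v = d" by (simp add: v)
  note I = nd_eqI[OF bij_PD[OF el u'(1), of v]]
  have "p \<noteq> u" using p u' r by auto
  consider "prefix p v" "p \<noteq> v" | "p = v" | "\<not> prefix p v" by blast
  then show ?thesis
  proof cases
    case 1
    define i where "i = length p"
    have i: "p = global_path rot i" "i < d"
      using 1 prefix_global_pathD[of p rot d] by (auto simp: v i_def le_less)
    have "nd h (PD u v el) e = global_path rot (Suc i)"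
    proof (rule I)
      show "global_path rot (Suc i) \<in> tree_nodes h"
        using i u'(1) by (simp add: tree_nodes_def d)
      show "PD u v el (global_path rot (Suc i)) = e"
        using prefix_global_path[of "Suc i" d rot] i p by (simp add: PD_def v)
    qed (simp add: lv d)
    then show ?thesis
      using weight_flip_global_path[of "Suc i" d rot] weight_global_path[of rot i] i
      by (simp add: p_def[symmetric] del: global_path.simps)
  next
    case 2
    have "\<not> prefix u v"
      using 2 \<open>p \<noteq> u\<close> lv d by (auto simp: prefix_def)
    then have "nd h (PD u v el) e = u"
      using u' p 2 lv d by (intro I) (auto simp: PD_def)
    \<comment> \<open>This is the maximum on level \<open>d\<close>, so the move to \<open>u\<close>
      on the same level cannot raise the weight, whatever the flipped pointers are.\<close>
    moreover have "weight rot p = real d + 1"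
      using 2 weight_global_path[of rot d] by (simp add: v)
    ultimately show ?thesis
      using weight_le[of "flip d rot" u] by (simp add: p_def[symmetric] d add_increasing2)
  next
    case 3
    then have "nd h (PD u v el) e = p"
      using p \<open>p \<noteq> u\<close> lv d by (intro I) (auto simp: PD_def)
    then show ?thesis
      using weight_flip[of d rot p] by (simp add: p_def[symmetric])
  qed
qed

section \<open>The potential\<close>

definition excess :: "rotors \<Rightarrow> node \<Rightarrow> node \<Rightarrow> real" where
  "excess rot p q = max 0 (weight rot p - 2 * real (length q) - 1)"

definition potential :: "nat \<Rightarrow> 'a set \<Rightarrow> 'a placement \<Rightarrow> rotors \<Rightarrow> 'a placement \<Rightarrow> real" where
  "potential h E el rot opt = (\<Sum>e\<in>E. 4 * excess rot (nd h el e) (nd h opt e))"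

lemma excess_nonneg: "0 \<le> excess rot p q"
  by (simp add: excess_def)

lemma potential_nonneg: "0 \<le> potential h E el rot opt"
  by (simp add: potential_def sum_nonneg excess_nonneg)

text \<open>At level \<open>k\<close> the weight is at most \<open>k + 1\<close>, hence at most
  \<open>2 * k + 1\<close>. Equal initial placements therefore leave no additive constant.\<close>

lemma potential_self: "potential h E el rot el = 0"
proof -
  have "excess rot p p = 0" for p
    using weight_le[of rot p] by (simp add: excess_def)
  then show ?thesis by (simp add: potential_def)
qed

text \<open>A positive new excess forces level at least \<open>2 * length q + 1\<close> on
  \<open>p'\<close>, because the weight is at most the level plus 1. Deep levels gain
  little.\<close>

lemma excess_gain:
  assumes "weight rot' p' \<le> weight rot p + (1 / 2) ^ length p'"
  shows "excess rot' p' q \<le> excess rot p q + (1 / 2) ^ (2 * length q + 1)"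
proof (cases "weight rot' p' \<le> 2 * real (length q) + 1")
  case True
  then show ?thesis by (simp add: excess_def)
next
  case False
  then have "real (2 * length q) < real (length p')"
    using weight_le[of rot' p'] by simp
  then have "2 * length q + 1 \<le> length p'"
    by linarith
  then have "(1 / 2 :: real) ^ length p' \<le> (1 / 2) ^ (2 * length q + 1)"
    by (intro power_decreasing) auto
  then show ?thesis
    using assms False by (simp add: excess_def)
qed

section \<open>Total gain over all elements\<close>

lemma finite_tree_nodes: "finite (tree_nodes h)"
  using finite_lists_length_le[of "UNIV :: bool set" h] by (simp add: tree_nodes_def)

text \<open>Level \<open>k\<close> contributes
  \<open>2 ^ k * (1 / 2) ^ (2 * k + 1) = (1 / 2) ^ (k + 1)\<close>, a geometric series.\<close>

lemma sum_tree_nodes: "(\<Sum>v\<in>tree_nodes h. (1 / 2 :: real) ^ (2 * length v + 1)) = 1 - (1 / 2) ^ (h + 1)"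
proof (induction h)
  case 0
  have "tree_nodes 0 = {[]}" by (auto simp: tree_nodes_def)
  then show ?case by simp
next
  case (Suc h)
  define L where "L = {v :: node. length v = Suc h}"
  have card: "card L = 2 ^ Suc h"
    using card_lists_length_eq[of "UNIV :: bool set" "Suc h"] by (simp add: L_def)
  then have "finite L"
    by (simp add: card_ge_0_finite)
  from card have "(\<Sum>v\<in>L. (1 / 2 :: real) ^ (2 * length v + 1)) = 2 ^ Suc h * (1 / 2) ^ (2 * Suc h + 1)"
    by (simp add: L_def)
  also have "\<dots> = (1 / 2) ^ (Suc h + 1)"
    by (simp add: power_add power_mult power_one_over field_simps power2_eq_square
        flip: power_mult_distrib)
  finally have *: "(\<Sum>v\<in>L. (1 / 2 :: real) ^ (2 * length v + 1)) = (1 / 2) ^ (Suc h + 1)" .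
  have "tree_nodes (Suc h) = tree_nodes h \<union> L" "tree_nodes h \<inter> L = {}"
    by (auto simp: tree_nodes_def L_def)
  then show ?case
    using Suc * \<open>finite L\<close> by (simp add: sum.union_disjoint finite_tree_nodes)
qed

lemma sum_gain_le:
  assumes "bij_betw opt (tree_nodes h) E"
  shows "(\<Sum>e\<in>E. (1 / 2 :: real) ^ (2 * length (nd h opt e) + 1)) \<le> 1"
proof -
  have "(\<Sum>e\<in>E. (1 / 2 :: real) ^ (2 * length (nd h opt e) + 1))
      = (\<Sum>v\<in>tree_nodes h. (1 / 2) ^ (2 * length (nd h opt (opt v)) + 1))"
    by (rule sum.reindex_bij_betw[OF assms, symmetric])
  also have "\<dots> = (\<Sum>v\<in>tree_nodes h. (1 / 2) ^ (2 * length v + 1))"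
    using nd_eqI[OF assms] by (intro sum.cong) auto
  also have "\<dots> \<le> 1"
    unfolding sum_tree_nodes by simp
  finally show ?thesis .
qed

section \<open>Change of the potential under swaps and requests\<close>

text \<open>The threshold of the element moved up falls by 2, and excesses count 4 times; no other
  excess grows.\<close>

lemma potential_swap:
  assumes opt: "bij_betw opt (tree_nodes h) E" and v: "v \<in> tree_nodes h" "v \<noteq> []"
  shows "potential h E el rot (swap_with_parent v opt) \<le> potential h E el rot opt + 8"
proof -
  have fin: "finite E"
    using opt finite_tree_nodes bij_betw_finite by blast
  have "potential h E el rot (swap_with_parent v opt)
      \<le> (\<Sum>e\<in>E. 4 * excess rot (nd h el e) (nd h opt e) + (if e = opt v then 8 else 0))"
    unfolding potential_def
  proof (rule sum_mono)
    fix e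
    assume "e \<in> E"
    from level_nd_swap[OF opt v this]
    have "real (length (nd h opt e)) \<le> real (length (nd h (swap_with_parent v opt) e))
        + (if e = opt v then 1 else 0)"
      by (auto split: if_splits)
    then show "4 * excess rot (nd h el e) (nd h (swap_with_parent v opt) e)
        \<le> 4 * excess rot (nd h el e) (nd h opt e) + (if e = opt v then 8 else 0)"
      by (cases "e = opt v") (simp_all add: excess_def max_def)
  qed
  also have "\<dots> \<le> potential h E el rot opt + 8"
    using fin by (simp add: potential_def sum.distrib)
  finally show ?thesis .
qed

text \<open>The constant 8 is 4 for the total gain of all excesses plus 4 for the summand 1 in the
  threshold of \<open>r\<close>.\<close>

lemma potential_serve:
  assumes el: "bij_betw el (tree_nodes h) E" and opt: "bij_betw opt (tree_nodes h) E"
    and r: "r \<in> E"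
    and u: "u = nd h el r" and d: "d = length u" and v: "v = global_path rot d"
  shows "potential h E (PD u v el) (flip d rot) opt + 4 * real d
    \<le> potential h E el rot opt + 8 * real (length (nd h opt r)) + 8"
proof -
  have fin: "finite E"
    using el finite_tree_nodes bij_betw_finite by blast
  have u': "u \<in> tree_nodes h" "el u = r"
    using nd_bij[OF el r] by (auto simp: u)
  define g :: "'a \<Rightarrow> real" where "g e = (1 / 2) ^ (2 * length (nd h opt e) + 1)" for e
  \<comment> \<open>A lower bound for the excess of \<open>r\<close>, all of which is lost as
    \<open>r\<close> moves to the root. A negative value is harmless.\<close>
  define drop where "drop = real d - 2 * real (length (nd h opt r)) - 1"
  \<comment> \<open>The gain \<open>g\<close> is granted to \<open>r\<close> as well, so that it can
    be summed over all of \<open>E\<close>.\<close>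
  have "potential h E (PD u v el) (flip d rot) opt
      \<le> (\<Sum>e\<in>E. 4 * excess rot (nd h el e) (nd h opt e) + 4 * g e - (if e = r then 4 * drop else 0))"
    unfolding potential_def
  proof (rule sum_mono)
    fix e
    assume e: "e \<in> E"
    show "4 * excess (flip d rot) (nd h (PD u v el) e) (nd h opt e)
        \<le> 4 * excess rot (nd h el e) (nd h opt e) + 4 * g e - (if e = r then 4 * drop else 0)"
    proof (cases "e = r")
      case True
      have "nd h (PD u v el) r = []"
        using u'(2) by (intro nd_eqI[OF bij_PD[OF el u'(1)]])
          (auto simp: PD_def tree_nodes_def v d)
      moreover have "excess (flip d rot) [] q = 0" for q
        by (simp add: excess_def weight_def)
      moreover have "drop \<le> excess rot u (nd h opt r)"
        using weight_ge[of u rot] by (simp add: drop_def excess_def d)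
      ultimately show ?thesis
        using True u by (simp add: g_def add_increasing2)
    next
      case False
      then show ?thesis
        using excess_gain[OF weight_gain[OF el e r False u d v], of "nd h opt e"]
        by (simp add: g_def)
    qed
  qed
  also have "\<dots> = potential h E el rot opt + 4 * sum g E - 4 * drop"
    using fin r by (simp add: potential_def sum.distrib sum_subtractf sum_distrib_left)
  also have "\<dots> \<le> potential h E el rot opt + 4 - 4 * drop"
    using sum_gain_le[OF opt] by (simp add: g_def)
  finally show ?thesis by (simp add: drop_def)
qed

section \<open>Amortised comparison with Opt\<close>

lemma total_cost_swaps:
  "total_cost h el (map Swap ws @ as) = length ws + total_cost h (fold swap_with_parent ws el) as"
  by (induction ws arbitrary: el) auto

text \<open>Induction over the actions of Opt rather than the requests amortises its swaps one at a
  time; Rotor-Push acts only at \<open>Serve\<close>.\<close>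

lemma rotor_push_le:
  assumes "bij_betw el (tree_nodes h) E" "bij_betw opt (tree_nodes h) E"
    and "served as \<in> lists E" "\<And>v. Swap v \<in> set as \<Longrightarrow> v \<in> tree_nodes h \<and> v \<noteq> []"
  shows "real (total_cost h el (rotor_push h el rot (served as)))
    \<le> 12 * real (total_cost h opt as) + potential h E el rot opt"
  using assms
proof (induction as arbitrary: el rot opt)
  case Nil
  then show ?case by (simp add: potential_nonneg)
next
  case (Cons a as)
  show ?case
  proof (cases a)
    case (Swap v)
    then have v: "v \<in> tree_nodes h" "v \<noteq> []"
      using Cons.prems(4) by auto
    have "real (total_cost h el (rotor_push h el rot (served as)))
        \<le> 12 * real (total_cost h (swap_with_parent v opt) as)
          + potential h E el rot (swap_with_parent v opt)"
      using Cons.prems Swap by (intro Cons.IH bij_swap_with_parent v) auto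
    \<comment> \<open>The swap pays 12, which covers the rise of the potential by at most 8.\<close>
    then show ?thesis
      using potential_swap[OF Cons.prems(2) v, of el rot] Swap by simp
  next
    case (Serve e)
    then have e: "e \<in> E" using Cons.prems(3) by simp
    define u where "u = nd h el e"
    define d where "d = length u"
    define v where "v = global_path rot d"
    have len: "length u = length v" by (simp add: v_def d_def)
    have u: "u \<in> tree_nodes h" using nd_bij[OF Cons.prems(1) e] by (simp add: u_def)
    have "total_cost h el (rotor_push h el rot (served (a # as)))
        = d + 1 + length (PD_swaps u v)
          + total_cost h (PD u v el) (rotor_push h (PD u v el) (flip d rot) (served as))"
      by (simp add: Serve Let_def total_cost_swaps PD_implementation[OF len]
          flip: u_def d_def v_def)
    moreover have "length (PD_swaps u v) \<le> 3 * d"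
      using length_PD_swaps[OF len] len d_def by simp
    moreover have "real (total_cost h (PD u v el)
          (rotor_push h (PD u v el) (flip d rot) (served as)))
        \<le> 12 * real (total_cost h opt as) + potential h E (PD u v el) (flip d rot) opt"
      using Cons.prems Serve by (intro Cons.IH bij_PD u len) auto
    moreover note potential_serve[OF Cons.prems(1,2) e u_def d_def v_def]
    \<comment> \<open>With \<open>k\<close> the level of \<open>e\<close> for Opt:
      \<open>(4 * d + 1) + (8 * k + 8 - 4 * d) = 8 * k + 9\<close>, at most
      \<open>12 * (k + 1)\<close>.\<close>
    ultimately show ?thesis
      by (simp add: Serve)
  qed
qed

theorem theorem1:
  fixes h :: nat and E :: "'a set" and el\<^sub>0 :: "'a placement"
    and Opt :: "'a list \<Rightarrow> 'a action list" and \<sigma> :: "'a list"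
  assumes "bij_betw el\<^sub>0 (tree_nodes h) E"
    and "offline_algorithm h E Opt"
    and "\<sigma> \<in> lists E"
  shows "total_cost h el\<^sub>0 (rotor_push h el\<^sub>0 initial_rotors \<sigma>) \<le> 12 * total_cost h el\<^sub>0 (Opt \<sigma>)"
proof -
  have "is_schedule h \<sigma> (Opt \<sigma>)"
    using assms(2,3) by (simp add: offline_algorithm_def)
  then have "real (total_cost h el\<^sub>0 (rotor_push h el\<^sub>0 initial_rotors \<sigma>))
      \<le> 12 * real (total_cost h el\<^sub>0 (Opt \<sigma>))"
    using rotor_push_le[OF assms(1,1), of "Opt \<sigma>" initial_rotors] assms(3)
    by (simp add: is_schedule_def potential_self)
  then show ?thesis by linarith
qed

end
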